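(* Let $\Bbbk$ be a field of characteristic zero, $N$ a positive integer, and $M=\bigoplus_{k\in\frac{1}{N}\mathbb{Z}}M_k$ a graded algebra of type $\frac{1}{N}\mathbb{Z}$ over $\Bbbk$. Let $\partial$ be a derivation of $M$ of degree $2$ and let $\mathcal{E}_4\in M_4$. Let $\widetilde{M}:=M[\mathcal{E}_2]=M\otimes_{\Bbbk}\Bbbk[\mathcal{E}_2]$, where $\mathcal{E}_2\notin M$ is an indeterminate of degree $2$, and let $\mathscr{D}$ be the degree-$2$ derivation of $\widetilde{M}$ determined on generators by $$\mathscr{D}(f)=\partial(f)+k\,\mathcal{E}_2 f\quad\text{for } f\in M_k,\qquad \mathscr{D}(\mathcal{E}_2)=\mathcal{E}_4+\mathcal{E}_2^2.$$ Then for every integer $n\ge 0$ and all $f\in M_k$, $g\in M_l$ with $k,l\in\frac{1}{N}\mathbb{Z}$, $$[f,g]_{\partial,\mathcal{E}_4,n}=[f,g]_{\mathscr{D},n}.$$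
   Context: A graded algebra of type $\frac{1}{N}\mathbb{Z}$ over $\Bbbk$ is a commutative, associative $\Bbbk$-algebra with unit $M=\bigoplus_{k\in\frac{1}{N}\mathbb{Z}}M_k$ with $M_kM_l\subseteq M_{k+l}$, $1\in M_0$, and $\dim_\Bbbk M_k<\infty$ for all $k$; elements of $M_k$ are called homogeneous of degree (weight) $k$. A derivation $\partial$ has degree $2$ if $\partial(M_k)\subseteq M_{k+2}$ for all $k$. $(x)_0=1$ and $(x)_n=x(x+1)\cdots(x+n-1)$ is the Pochhammer symbol. For $h\in M_k$ define recursively $\partial_{(0)}h=h$, $\partial_{(1)}h=\partial h$, and $\partial_{(j+1)}h=\partial(\partial_{(j)}h)+j(j+k-1)\mathcal{E}_4\,\partial_{(j-1)}h$ for $j\ge1$. For $f\in M_k$, $g\in M_l$ and $n\ge0$, $$[f,g]_{\partial,\mathcal{E}_4,n}:=\sum_{j=0}^n(-1)^j\frac{(k+j)_{n-j}(l+n-j)_j}{j!(n-j)!}\,\partial_{(j)}f\,\partial_{(n-j)}g,$$ and for homogeneous $f\in\widetilde{M}_k$, $g\in\widetilde{M}_l$, $$[f,g]_{\mathscr{D},n}:=\sum_{j=0}^n(-1)^j\frac{(k+j)_{n-j}(l+n-j)_j}{j!(n-j)!}\,\mathscr{D}^{j}f\,\mathscr{D}^{n-j}g,$$ where $\mathscr{D}^j$ is the $j$-th iterate of $\mathscr{D}$. *)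

theory Defs
  imports Complex_Main "HOL-Computational_Algebra.Polynomial"
begin

definition degrees :: "nat \<Rightarrow> rat set" where
  "degrees N = {of_int a / of_nat N | a. True}"

text \<open>The whole type \<open>'m\<close> is the algebra, and \<open>M k\<close> is its homogeneous component of
  degree \<open>k\<close>. Only the values \<open>M k\<close> with \<open>k \<in> degrees N\<close> carry information.\<close>

locale graded_algebra = vector_space scale
  for scale :: "'k::field_char_0 \<Rightarrow> 'm::comm_ring_1 \<Rightarrow> 'm" (infixr \<open>*s\<close> 75)
    and N :: nat
    and M :: "rat \<Rightarrow> 'm set" +
  assumes scale_mult_left: "(c *s x) * y = c *s (x * y)"
    and subspace_component: "k \<in> degrees N \<Longrightarrow> subspace (M k)"
    and direct_sum:
      "\<exists>!c. (\<forall>k\<in>degrees N. c k \<in> M k) \<and> (\<forall>k. k \<notin> degrees N \<longrightarrow> c k = 0) \<and>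
            finite {k. c k \<noteq> 0} \<and> x = (\<Sum>k | c k \<noteq> 0. c k)"
    and mult_component:
      "\<lbrakk>k \<in> degrees N; l \<in> degrees N; x \<in> M k; y \<in> M l\<rbrakk> \<Longrightarrow> x * y \<in> M (k + l)"
    and one_component: "1 \<in> M 0"
    and finite_dim_component: "k \<in> degrees N \<Longrightarrow> \<exists>B. finite B \<and> span B = M k"

definition derivation :: "('k::field \<Rightarrow> 'a::comm_ring \<Rightarrow> 'a) \<Rightarrow> ('a \<Rightarrow> 'a) \<Rightarrow> bool" where
  "derivation s T \<longleftrightarrow> Vector_Spaces.linear s s T \<and> (\<forall>x y. T (x * y) = T x * y + x * T y)"

definition has_degree :: "nat \<Rightarrow> (rat \<Rightarrow> 'a set) \<Rightarrow> rat \<Rightarrow> ('a \<Rightarrow> 'a) \<Rightarrow> bool" where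
  "has_degree N G r T \<longleftrightarrow> (\<forall>k\<in>degrees N. \<forall>x\<in>G k. T x \<in> G (k + r))"

text \<open>The extension of \<open>M\<close> by an indeterminate of degree 2 is the polynomial ring \<open>'m poly\<close>,
  with \<open>M\<close> embedded as the constant polynomials \<open>[:f:]\<close>. The coefficient of the \<open>i\<close>-th power of
  the indeterminate in an element of degree \<open>k\<close> has degree \<open>k - 2 * i\<close>.\<close>

abbreviation E2 :: "'m::comm_ring_1 poly" where
  "E2 \<equiv> [:0, 1:]"

definition poly_scale :: "('k \<Rightarrow> 'm \<Rightarrow> 'm) \<Rightarrow> 'k \<Rightarrow> 'm::comm_ring_1 poly \<Rightarrow> 'm poly" where
  "poly_scale scale c p = map_poly (scale c) p"

definition poly_component :: "(rat \<Rightarrow> 'm set) \<Rightarrow> rat \<Rightarrow> 'm::comm_ring_1 poly set" where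
  "poly_component M k = {p. \<forall>i. coeff p i \<in> M (k - 2 * of_nat i)}"

fun higher_deriv ::
  "('k::field_char_0 \<Rightarrow> 'm::comm_ring_1 \<Rightarrow> 'm) \<Rightarrow> ('m \<Rightarrow> 'm) \<Rightarrow> 'm \<Rightarrow> rat \<Rightarrow> nat \<Rightarrow> 'm \<Rightarrow> 'm"
where
  "higher_deriv scale d E4 k 0 h = h"
| "higher_deriv scale d E4 k (Suc 0) h = d h"
| "higher_deriv scale d E4 k (Suc (Suc i)) h =
     (let j = Suc i in
       d (higher_deriv scale d E4 k j h) +
       scale (of_nat j * (of_nat j + of_rat k - 1)) (E4 * higher_deriv scale d E4 k (j - 1) h))"

definition RC_coeff :: "rat \<Rightarrow> rat \<Rightarrow> nat \<Rightarrow> nat \<Rightarrow> 'k::field_char_0" where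
  "RC_coeff k l n j =
     (- 1) ^ j *
     ((pochhammer (of_rat k + of_nat j) (n - j) * pochhammer (of_rat l + of_nat (n - j)) j) /
      (fact j * fact (n - j)))"

text \<open>The weights \<open>k\<close> and \<open>l\<close> of the two arguments are passed explicitly, since the zero
  element is homogeneous of every degree.\<close>

definition RC_bracket ::
  "('k::field_char_0 \<Rightarrow> 'm::comm_ring_1 \<Rightarrow> 'm) \<Rightarrow> ('m \<Rightarrow> 'm) \<Rightarrow> 'm \<Rightarrow> nat \<Rightarrow>
   rat \<Rightarrow> rat \<Rightarrow> 'm \<Rightarrow> 'm \<Rightarrow> 'm"
where
  "RC_bracket scale d E4 n k l f g =
     (\<Sum>j=0..n. scale (RC_coeff k l n j)
        (higher_deriv scale d E4 k j f * higher_deriv scale d E4 l (n - j) g))"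

definition RC_bracket_poly ::
  "('k::field_char_0 \<Rightarrow> 'm::comm_ring_1 \<Rightarrow> 'm) \<Rightarrow> ('m poly \<Rightarrow> 'm poly) \<Rightarrow> nat \<Rightarrow>
   rat \<Rightarrow> rat \<Rightarrow> 'm poly \<Rightarrow> 'm poly \<Rightarrow> 'm poly"
where
  "RC_bracket_poly scale D n k l F G =
     (\<Sum>j=0..n. poly_scale scale (RC_coeff k l n j) ((D ^^ j) F * (D ^^ (n - j)) G))"

text \<open>If \<open>N > 0\<close>, \<open>d\<close> is a derivation of degree 2 and \<open>E4\<close> lies in \<open>M 4\<close>, then exactly one \<open>D\<close>
  satisfies these conditions.\<close>

definition extended_derivation ::
  "('k::field_char_0 \<Rightarrow> 'm::comm_ring_1 \<Rightarrow> 'm) \<Rightarrow> nat \<Rightarrow> (rat \<Rightarrow> 'm set) \<Rightarrow>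
   ('m \<Rightarrow> 'm) \<Rightarrow> 'm \<Rightarrow> ('m poly \<Rightarrow> 'm poly) \<Rightarrow> bool"
where
  "extended_derivation scale N M d E4 D \<longleftrightarrow>
     derivation (poly_scale scale) D \<and>
     has_degree N (poly_component M) 2 D \<and>
     (\<forall>k\<in>degrees N. \<forall>f\<in>M k.
        D [:f:] = [:d f:] + poly_scale scale (of_rat k) (E2 * [:f:])) \<and>
     D E2 = [:E4:] + E2 ^ 2"

end

theory Submission
  imports Defs
begin

text \<open>Writing \<open>\<partial>\<^sub>a f\<close> for \<open>higher_deriv\<close>, induction on \<open>n\<close> gives
  \<open>D\<^sup>n f = (\<Sum>a\<le>n. (n choose a) * (k + a)\<^sub>n\<^sub>-\<^sub>a * E2 ^ (n - a) * \<partial>\<^sub>a f)\<close>; the recursion for \<open>\<partial>\<^sub>a\<close> is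
  exactly what absorbs the term \<open>E4\<close> of \<open>D E2\<close>. Substituted into the bracket, the coefficient of
  \<open>E2 ^ m * \<partial>\<^sub>a f * \<partial>\<^sub>b g\<close> becomes a multiple of \<open>(1 - 1) ^ m\<close>, so only \<open>m = 0\<close> survives.\<close>

section \<open>Expansion of the iterates of a derivation\<close>

definition ladder_coeff :: "'k::field_char_0 \<Rightarrow> nat \<Rightarrow> nat \<Rightarrow> 'k" where
  "ladder_coeff x n a = of_nat (n choose a) * pochhammer (x + of_nat a) (n - a)"

lemma choose_mult_diff: "(n choose a) * (n - a) = (n choose Suc a) * Suc a"
proof (cases "a < n")
  case True
  then obtain m where "n = Suc m"
    by (cases n) auto
  then show ?thesis
    using binomial_absorb_comp[of n a] Suc_times_binomial_eq[of m a] by (simp add: mult.commute)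
qed (auto simp: not_less)

text \<open>Both sides equal \<open>(n choose (a + 1)) * (a + 1) * (x + a)\<close> times a common
  Pochhammer symbol. The left side is the coefficient of the \<open>e\<close>-term obtained by
  differentiating \<open>E ^ (n - a)\<close>, the right side that of the correction term in the
  derivative of \<open>H (a + 1)\<close>; their equality makes \<open>e\<close> disappear.\<close>

lemma ladder_coeff_lower:
  fixes x :: "'k::field_char_0"
  assumes "a < n"
  shows "ladder_coeff x n a * of_nat (n - a) =
    ladder_coeff x n (Suc a) * (of_nat (Suc a) * (of_nat (Suc a) + x - 1))"
proof -
  have n: "n - a = Suc (n - Suc a)"
    using assms by simp
  have "of_nat (n choose a) * of_nat (n - a) = (of_nat (n choose Suc a) * of_nat (Suc a) :: 'k)"
    by (metis of_nat_mult choose_mult_diff)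
  moreover have "pochhammer (x + of_nat a) (n - a) =
      (x + of_nat a) * pochhammer (x + of_nat (Suc a)) (n - Suc a)"
    unfolding n by (simp add: pochhammer_rec add_ac)
  moreover have "of_nat (Suc a) + x - 1 = x + of_nat a"
    by simp
  ultimately show ?thesis
    unfolding ladder_coeff_def by algebra
qed

text \<open>The recursion obtained by applying \<open>D\<close> once more. The first summand comes
  from \<open>H (a + 1)\<close> keeping its index, with factor
  \<open>(n - a - 1) + (x + 2 * (a + 1))\<close>, the second from \<open>H a\<close> being raised.
  For \<open>a < n\<close>, after division by the common Pochhammer factor \<open>p\<close>, only
  Pascal's rule and \<open>choose_mult_diff\<close> remain.\<close>

lemma ladder_coeff_Suc:
  fixes x :: "'k::field_char_0"
  assumes "a \<le> n"
  shows "ladder_coeff x (Suc n) (Suc a) =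
    ladder_coeff x n (Suc a) * (of_nat (n + Suc a) + x) + ladder_coeff x n a"
proof (cases "a = n")
  case True
  then show ?thesis by (simp add: ladder_coeff_def)
next
  case False
  with assms obtain m where n: "n = Suc (a + m)"
    using less_iff_Suc_add le_neq_implies_less by metis
  define p where "p = pochhammer (x + of_nat (Suc a)) m"
  have 1: "of_nat (n choose a) * of_nat (Suc m) = (of_nat (n choose Suc a) * of_nat (Suc a) :: 'k)"
    using choose_mult_diff[of n a] unfolding of_nat_mult[symmetric] by (simp add: n)
  have 2: "pochhammer (x + of_nat (Suc a)) (Suc n - Suc a) = (x + of_nat n) * p"
    by (simp add: n p_def pochhammer_Suc algebra_simps)
  have 3: "pochhammer (x + of_nat a) (n - a) = (x + of_nat a) * p"
    by (simp add: n p_def pochhammer_rec Suc_diff_le add_ac)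
  have 4: "pochhammer (x + of_nat (Suc a)) (n - Suc a) = p"
    by (simp add: n p_def)
  have 5: "(of_nat (Suc n choose Suc a)::'k) = of_nat (n choose a) + of_nat (n choose Suc a)"
    by simp
  have 6: "(of_nat n :: 'k) = of_nat a + of_nat (Suc m)"
      "(of_nat (n + Suc a) :: 'k) = of_nat n + of_nat (Suc a)"
    by (simp_all add: n)
  show ?thesis
    unfolding ladder_coeff_def 2 3 4 5 using 1 6 by algebra
qed

lemma ladder_coeff_Suc_0: "ladder_coeff x (Suc n) 0 = ladder_coeff x n 0 * (of_nat n + x)"
  by (simp add: ladder_coeff_def pochhammer_Suc algebra_simps)

text \<open>Scalars are turned into ring elements, so that the expansions become identities in a
  commutative ring. The instance used later is \<open>c \<mapsto> [:c *s 1:]\<close>.\<close>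

locale scalar_hom =
  fixes S :: "'k::field_char_0 \<Rightarrow> 'r::comm_ring_1"
  assumes S_add: "S (a + b) = S a + S b"
    and S_mult: "S (a * b) = S a * S b"
    and S_1: "S 1 = 1"
begin

lemma S_0: "S 0 = 0"
  using S_add[of 0 0] by simp

lemma S_of_nat: "S (of_nat m) = of_nat m"
  by (induction m) (simp_all add: S_0 S_1 S_add)

lemma S_sum: "S (sum c A) = (\<Sum>x\<in>A. S (c x))"
  by (induction A rule: infinite_finite_induct) (simp_all add: S_0 S_add)

text \<open>Here \<open>H a\<close> stands for \<open>\<partial>\<^sub>a f\<close> and
  \<open>e\<close> for \<open>E4\<close>. Assumption \<open>D_H\<close> is the rule for
  \<open>D\<close> in weight \<open>x + 2 * a\<close>, with \<open>d\<close> eliminated by the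
  recursion for \<open>\<partial>\<^sub>a\<close>.\<close>

lemma ladder_expansion:
  fixes D :: "'r \<Rightarrow> 'r" and H :: "nat \<Rightarrow> 'r"
  assumes D_add: "\<And>u v. D (u + v) = D u + D v"
    and D_S: "\<And>c u. D (S c * u) = S c * D u"
    and D_mult: "\<And>u v. D (u * v) = D u * v + u * D v"
    and D_E: "D E = e + E ^ 2"
    and D_H: "\<And>a. D (H a) = H (Suc a) - S (of_nat a * (of_nat a + x - 1)) * (e * H (a - 1))
        + S (x + 2 * of_nat a) * (E * H a)"
  shows "(D ^^ n) (H 0) = (\<Sum>a\<le>n. S (ladder_coeff x n a) * (E ^ (n - a) * H a))"
proof (induction n)
  case 0
  show ?case by (simp add: ladder_coeff_def S_1)
next
  case (Suc n)
  have D_0: "D 0 = 0"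
    using D_add[of 0 0] by simp
  have D_sum: "D (sum u A) = (\<Sum>i\<in>A. D (u i))" for u :: "nat \<Rightarrow> 'r" and A
    by (induction A rule: infinite_finite_induct) (simp_all add: D_0 D_add)
  have D_1: "D 1 = 0"
    using D_mult[of 1 1] by simp
  have D_power: "D (E ^ m) = of_nat m * (E ^ (m - 1) * e) + of_nat m * E ^ Suc m" for m
  proof (induction m)
    case 0
    show ?case by (simp add: D_1)
  next
    case (Suc m)
    then show ?case
      by (cases m) (simp_all add: D_mult D_E D_1 algebra_simps power2_eq_square)
  qed
  define c where "c = ladder_coeff x n"
  \<comment> \<open>The derivative of the \<open>a\<close>-th summand, sorted by origin:
    \<open>X\<close> keeps \<open>H a\<close> and gains a factor \<open>E\<close>, \<open>Y\<close>
    raises \<open>H a\<close>, \<open>Z\<close> contains the \<open>e\<close> from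
    \<open>D E\<close>, and \<open>W\<close> the \<open>e\<close> from \<open>D_H\<close>.\<close>
  define X where "X a = S (c a * (of_nat (n + a) + x)) * (E ^ (Suc n - a) * H a)" for a
  define Y where "Y a = S (c a) * (E ^ (n - a) * H (Suc a))" for a
  define Z where "Z a = S (c a * of_nat (n - a)) * (E ^ (n - a - 1) * e * H a)" for a
  define W where "W a = S (c a * (of_nat a * (of_nat a + x - 1))) * (E ^ (n - a) * e * H (a - 1))"
    for a
  have step: "D (S (c a) * (E ^ (n - a) * H a)) = X a + Y a + (Z a - W a)" if "a \<le> n" for a
  proof -
    have "of_nat (n + a) + x = of_nat (n - a) + (x + 2 * of_nat a)"
      using that by (simp add: of_nat_diff)
    then have "S (of_nat (n + a) + x) = of_nat (n - a) + S (x + 2 * of_nat a)"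
      by (metis S_add S_of_nat)
    then have "X a = S (c a) * (of_nat (n - a) + S (x + 2 * of_nat a)) * (E ^ Suc (n - a) * H a)"
      using that by (simp add: X_def S_mult Suc_diff_le)
    moreover have "W a = S (c a) * (E ^ (n - a) * (S (of_nat a * (of_nat a + x - 1)) * (e * H (a - 1))))"
      by (simp only: W_def S_mult mult_ac)
    moreover have "Z a = S (c a) * (of_nat (n - a) * (E ^ (n - a - 1) * e) * H a)"
      by (simp only: Z_def S_mult S_of_nat mult_ac)
    moreover have "D (S (c a) * (E ^ (n - a) * H a)) =
        S (c a) * (D (E ^ (n - a)) * H a + E ^ (n - a) * D (H a))"
      unfolding D_S by (simp only: D_mult)
    ultimately show ?thesis
      by (simp add: Y_def D_power D_H algebra_simps)
  qed
  \<comment> \<open>\<open>Z\<close> and \<open>W\<close> cancel after an index shift by one. The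
    boundary terms \<open>Z n\<close> and \<open>W 0\<close> have a zero factor, so the truncated
    \<open>H (0 - 1)\<close> is harmless.\<close>
  have "sum Z {..n} = sum Z {..<n}"
    by (simp add: lessThan_Suc_atMost[symmetric] Z_def S_0)
  also have "\<dots> = (\<Sum>a<n. W (Suc a))"
  proof (rule sum.cong)
    fix a assume "a \<in> {..<n}"
    then show "Z a = W (Suc a)"
      using ladder_coeff_lower[of a n x] by (simp add: Z_def W_def c_def)
  qed simp
  also have "\<dots> = sum W {..n}"
    by (simp add: lessThan_Suc_atMost[symmetric] sum.lessThan_Suc_shift W_def S_0 del: sum.lessThan_Suc)
  finally have ZW: "sum Z {..n} = sum W {..n}" .
  \<comment> \<open>\<open>X (Suc n)\<close> contains \<open>n choose Suc n\<close>, hence vanishes;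
    adding it lets \<open>X (Suc a)\<close> pair with \<open>Y a\<close>.\<close>
  have "sum X {..n} = sum X {..Suc n}"
    by (simp add: X_def c_def ladder_coeff_def binomial_eq_0 S_0)
  also have "\<dots> = X 0 + (\<Sum>a\<le>n. X (Suc a))"
    by (rule sum.atMost_Suc_shift)
  finally have X: "sum X {..n} = X 0 + (\<Sum>a\<le>n. X (Suc a))" .
  have "(D ^^ Suc n) (H 0) = (\<Sum>a\<le>n. X a + Y a + (Z a - W a))"
    by (simp add: Suc D_sum step flip: c_def)
  also have "\<dots> = X 0 + (\<Sum>a\<le>n. X (Suc a) + Y a)"
    by (simp add: sum.distrib sum_subtractf ZW X)
  also have "\<dots> = S (ladder_coeff x (Suc n) 0) * (E ^ (Suc n - 0) * H 0) +
      (\<Sum>a\<le>n. S (ladder_coeff x (Suc n) (Suc a)) * (E ^ (Suc n - Suc a) * H (Suc a)))"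
    by (intro arg_cong2[where f = plus] sum.cong refl)
      (simp_all add: X_def Y_def c_def ladder_coeff_Suc_0 ladder_coeff_Suc S_add algebra_simps)
  also have "\<dots> = (\<Sum>a\<le>Suc n. S (ladder_coeff x (Suc n) a) * (E ^ (Suc n - a) * H a))"
    by (rule sum.atMost_Suc_shift[symmetric])
  finally show ?case .
qed

end

section \<open>Cancellation in the bracket\<close>

lemma alternating_fact_sum:
  assumes "a + b \<le> n"
  shows "(\<Sum>j=a..n-b. (- 1) ^ j / (fact (j - a) * fact (n - j - b))) =
    (if a + b = n then (- 1) ^ a else (0::'k::field_char_0))"
proof -
  obtain m where n: "n = a + b + m"
    using assms le_Suc_ex by blast
  have "(\<Sum>j=a..n-b. (- 1) ^ j / (fact (j - a) * fact (n - j - b))) =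
      (\<Sum>i\<le>m. (- 1) ^ (a + i) / (fact i * fact (m - i)) :: 'k)"
    by (rule sum.reindex_bij_witness[of _ "\<lambda>i. a + i" "\<lambda>j. j - a"])
      (auto simp: n intro!: arg_cong[where f = fact])
  \<comment> \<open>The reciprocal factorials are \<open>(m choose i) / m!\<close>, so the sum
    expands \<open>(1 - 1) ^ m\<close>, which is zero unless \<open>m = 0\<close>.\<close>
  also have "\<dots> = (- 1) ^ a / fact m * (\<Sum>i\<le>m. (- 1) ^ i * of_nat (m choose i))"
    by (simp add: sum_distrib_left power_add binomial_fact divide_simps mult_ac)
  also have "\<dots> = (if a + b = n then (- 1) ^ a else 0)"
  proof (cases "m = 0")
    case False
    then show ?thesis
      using choose_alternating_sum[of m, where ?'a = 'k] by (simp add: n)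
  qed (simp add: n)
  finally show ?thesis .
qed

text \<open>Multiplied by the Pochhammer symbols of the bracket, those of the expansion telescope to a
  factor that does not depend on the summation index, which leaves the expansion of
  \<open>(1 - 1) ^ (n - a - b)\<close>.\<close>

lemma RC_ladder_coeff_sum:
  assumes "a + b \<le> n"
  shows "(\<Sum>j=a..n-b. RC_coeff k l n j * ladder_coeff (of_rat k) j a *
      ladder_coeff (of_rat l) (n - j) b) =
    (if a + b = n then RC_coeff k l n a else (0::'k::field_char_0))"
proof -
  define P :: 'k where "P = pochhammer (of_rat k + of_nat a) (n - a)"
  define Q :: 'k where "Q = pochhammer (of_rat l + of_nat b) (n - b)"
  have telescope: "RC_coeff k l n j * ladder_coeff (of_rat k) j a * ladder_coeff (of_rat l) (n - j) b
      = P * Q / (fact a * fact b) * ((- 1) ^ j / (fact (j - a) * fact (n - j - b)))"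
    if j: "j \<in> {a..n-b}" for j
  proof -
    have "a \<le> j" "j \<le> n" "b \<le> n - j" using j assms by auto
    have P: "P = pochhammer (of_rat k + of_nat a) (j - a) * pochhammer (of_rat k + of_nat j) (n - j)"
      using pochhammer_product[of "j - a" "n - a" "of_rat k + of_nat a :: 'k"] \<open>a \<le> j\<close> \<open>j \<le> n\<close>
      by (simp add: P_def of_nat_diff)
    have Q: "Q = pochhammer (of_rat l + of_nat b) (n - j - b) *
        pochhammer (of_rat l + of_nat (n - j)) j"
      using pochhammer_product[of "n - j - b" "n - b" "of_rat l + of_nat b :: 'k"]
        \<open>j \<le> n\<close> \<open>b \<le> n - j\<close>
      by (simp add: Q_def of_nat_diff)
    show ?thesis
      unfolding P Q RC_coeff_def ladder_coeff_def
      using binomial_fact[OF \<open>a \<le> j\<close>, where ?'a = 'k] binomial_fact[OF \<open>b \<le> n - j\<close>, where ?'a = 'k]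
      by (simp add: mult_ac)
  qed
  have "(\<Sum>j=a..n-b. RC_coeff k l n j * ladder_coeff (of_rat k) j a *
      ladder_coeff (of_rat l) (n - j) b) = P * Q / (fact a * fact b) *
      (\<Sum>j=a..n-b. (- 1) ^ j / (fact (j - a) * fact (n - j - b)))"
    unfolding sum_distrib_left using telescope by (rule sum.cong[OF refl])
  \<comment> \<open>When \<open>a + b = n\<close>, the lengths \<open>n - a\<close> and
    \<open>n - b\<close> are \<open>b\<close> and \<open>a\<close>, so the prefactor times
    \<open>(- 1) ^ a\<close> is the bracket coefficient itself.\<close>
  also have "\<dots> = (if a + b = n then RC_coeff k l n a else 0)"
    unfolding alternating_fact_sum[OF assms] by (auto simp: P_def Q_def RC_coeff_def)
  finally show ?thesis .
qed

text \<open>The power of \<open>E\<close> multiplying \<open>F a * G b\<close> is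
  \<open>n - a - b\<close>, independent of \<open>j\<close>. Hence the sum over \<open>j\<close> can
  be done first, on scalars alone, and leaves only \<open>b = n - a\<close>.\<close>

lemma (in scalar_hom) RC_ladder_sum:
  "(\<Sum>j\<le>n. S (RC_coeff k l n j) *
      ((\<Sum>a\<le>j. S (ladder_coeff (of_rat k) j a) * (E ^ (j - a) * F a)) *
       (\<Sum>b\<le>n - j. S (ladder_coeff (of_rat l) (n - j) b) * (E ^ (n - j - b) * G b)))) =
    (\<Sum>a\<le>n. S (RC_coeff k l n a) * (F a * G (n - a)))"
proof -
  define t where "t j a b = (RC_coeff k l n j * ladder_coeff (of_rat k) j a *
      ladder_coeff (of_rat l) (n - j) b :: 'k)" for j a b
  have "(\<Sum>j\<le>n. S (RC_coeff k l n j) *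
      ((\<Sum>a\<le>j. S (ladder_coeff (of_rat k) j a) * (E ^ (j - a) * F a)) *
       (\<Sum>b\<le>n - j. S (ladder_coeff (of_rat l) (n - j) b) * (E ^ (n - j - b) * G b)))) =
      (\<Sum>j\<le>n. \<Sum>a\<le>j. \<Sum>b\<le>n - j. S (t j a b) * (E ^ (n - a - b) * (F a * G b)))"
  proof (intro sum.cong refl, unfold sum_product, unfold sum_distrib_left, intro sum.cong refl)
    fix j a b assume "j \<in> {..n}" "a \<in> {..j}" "b \<in> {..n - j}"
    then have "n - a - b = (j - a) + (n - j - b)" by auto
    then show "S (RC_coeff k l n j) *
        (S (ladder_coeff (of_rat k) j a) * (E ^ (j - a) * F a) *
         (S (ladder_coeff (of_rat l) (n - j) b) * (E ^ (n - j - b) * G b))) =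
        S (t j a b) * (E ^ (n - a - b) * (F a * G b))"
      by (simp only: t_def S_mult power_add mult_ac)
  qed
  \<comment> \<open>The conditions \<open>a \<le> j\<close> and \<open>b \<le> n - j\<close> say
    that \<open>j\<close> runs from \<open>a\<close> to \<open>n - b\<close>; such \<open>j\<close>
    exist exactly when \<open>a + b \<le> n\<close>.\<close>
  also have "\<dots> = (\<Sum>a\<le>n. \<Sum>b\<le>n - a. \<Sum>j=a..n-b. S (t j a b) * (E ^ (n - a - b) * (F a * G b)))"
    by (simp add: sum.Sigma, rule sum.reindex_bij_witness[of _ "\<lambda>(a, b, j). (j, a, b)" "\<lambda>(j, a, b). (a, b, j)"]) auto
  also have "\<dots> = (\<Sum>a\<le>n. \<Sum>b\<le>n - a. S (\<Sum>j=a..n-b. t j a b) * (E ^ (n - a - b) * (F a * G b)))"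
    by (simp add: S_sum sum_distrib_right)
  also have "\<dots> = (\<Sum>a\<le>n. \<Sum>b\<le>n - a. if b = n - a then S (RC_coeff k l n a) * (F a * G b) else 0)"
    by (intro sum.cong refl) (auto simp: t_def RC_ladder_coeff_sum S_0)
  also have "\<dots> = (\<Sum>a\<le>n. S (RC_coeff k l n a) * (F a * G (n - a)))"
    by simp
  finally show ?thesis .
qed

section \<open>Graded algebras and the extended derivation\<close>

lemma degrees_add_of_nat:
  assumes "N > 0" "k \<in> degrees N"
  shows "k + of_nat m \<in> degrees N"
proof -
  obtain a where "k = of_int a / of_nat N"
    using assms by (auto simp: degrees_def)
  then have "k + of_nat m = of_int (a + int m * int N) / of_nat N"
    using assms by (simp add: field_simps)
  then show ?thesis
    unfolding degrees_def by blast
qed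

text \<open>Both summands of the recursion have equal weight: \<open>d\<close> adds 2 to the
  previous term, \<open>E4\<close> adds 4 to the one before. The weight determines the factor of
  \<open>E2\<close> when \<open>D\<close> is applied to \<open>\<partial>\<^sub>j f\<close>.\<close>

lemma (in graded_algebra) higher_deriv_component:
  assumes "N > 0" and deg: "has_degree N M 2 d" and "E4 \<in> M 4"
    and "k \<in> degrees N" "f \<in> M k"
  shows "higher_deriv scale d E4 k j f \<in> M (k + 2 * of_nat j)"
proof -
  have degs: "k + 2 * of_nat i \<in> degrees N" for i
    using degrees_add_of_nat[OF assms(1,4), of "2 * i"] by simp
  have "0 \<in> degrees N"
    unfolding degrees_def by (auto intro!: exI[of _ 0])
  from degrees_add_of_nat[OF assms(1) this, of 4] have four: "4 \<in> degrees N"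
    by simp
  have d: "d y \<in> M (k + 2 * of_nat (Suc i))" if "y \<in> M (k + 2 * of_nat i)" for y i
    using deg degs[of i] that unfolding has_degree_def by (auto simp: algebra_simps)
  show ?thesis
  proof (induction j rule: induct_nat_012)
    case 0
    show ?case using assms by simp
  next
    case 1
    show ?case using d[of f 0] assms by simp
  next
    case (ge2 j)
    have "E4 * higher_deriv scale d E4 k j f \<in> M (4 + (k + 2 * of_nat j))"
      using mult_component[OF four degs assms(3) ge2(1)] .
    also have "4 + (k + 2 * of_nat j) = k + 2 * of_nat (Suc (Suc j))"
      by (simp add: algebra_simps)
    finally show ?case
      unfolding higher_deriv.simps Let_def diff_Suc_1
      by (intro subspace_add subspace_scale subspace_component[OF degs] d[OF ge2(2)])
  qed
qed

lemma (in graded_algebra) scalar_hom_const_poly: "scalar_hom (\<lambda>c. [:c *s 1:])"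
proof
  fix a b
  show "[:(a * b) *s 1:] = [:a *s 1:] * [:b *s 1:]"
    by (simp add: scale_mult_left)
qed (simp_all add: scale_left_distrib)

lemma (in graded_algebra) scale_eq_mult: "c *s x = (c *s 1) * x"
  by (simp add: scale_mult_left)

lemma (in graded_algebra) mult_scale_1: "x * (c *s 1) = c *s x"
  by (simp add: scale_mult_left mult.commute[of x])

lemma (in graded_algebra) poly_scale_eq_mult: "poly_scale scale c p = [:c *s 1:] * p"
  unfolding poly_scale_def by (rule poly_eqI) (simp add: coeff_map_poly scale_eq_mult[symmetric])

lemma (in graded_algebra) iterate_extended_derivation:
  assumes "N > 0" and "has_degree N M 2 d" and "E4 \<in> M 4"
    and ext: "extended_derivation scale N M d E4 D"
    and "k \<in> degrees N" "f \<in> M k"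
  shows "(D ^^ n) [:f:] = (\<Sum>a\<le>n. [:ladder_coeff (of_rat k) n a *s 1:] *
    (E2 ^ (n - a) * [:higher_deriv scale d E4 k a f:]))"
proof -
  interpret scalar_hom "\<lambda>c. [:c *s 1:]"
    by (rule scalar_hom_const_poly)
  have der: "derivation (poly_scale scale) D"
    using ext unfolding extended_derivation_def by blast
  then interpret D: Vector_Spaces.linear "poly_scale scale" "poly_scale scale" D
    unfolding derivation_def by blast
  define H where "H a = [:higher_deriv scale d E4 k a f:]" for a
  have "(D ^^ n) (H 0) = (\<Sum>a\<le>n. [:ladder_coeff (of_rat k) n a *s 1:] * (E2 ^ (n - a) * H a))"
  proof (rule ladder_expansion)
    show "D ([:c *s 1:] * u) = [:c *s 1:] * D u" for c u
      using D.scale[of c u] by (simp only: poly_scale_eq_mult)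
    show "D (u * v) = D u * v + u * D v" for u v
      using der unfolding derivation_def by blast
    show "D E2 = [:E4:] + E2 ^ 2"
      using ext unfolding extended_derivation_def by blast
    show "D (H a) = H (Suc a)
        - [:(of_nat a * (of_nat a + of_rat k - 1)) *s 1:] * ([:E4:] * H (a - 1))
        + [:(of_rat k + 2 * of_nat a) *s 1:] * (E2 * H a)" for a
    proof -
      define h where "h = higher_deriv scale d E4 k a f"
      have "h \<in> M (k + 2 * of_nat a)" "k + 2 * of_nat a \<in> degrees N"
        using higher_deriv_component[OF assms(1-3,5,6)] degrees_add_of_nat[OF assms(1,5), of "2 * a"]
        by (simp_all add: h_def)
      then have "D (H a) = [:d h:] + poly_scale scale (of_rat (k + 2 * of_nat a)) (E2 * H a)"
        using ext unfolding extended_derivation_def H_def h_def by blast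
      moreover have "(of_rat (k + 2 * of_nat a) :: 'k) = of_rat k + 2 * of_nat a"
        by (simp add: of_rat_add of_rat_mult)
      \<comment> \<open>The recursion solved for \<open>d h\<close>. For \<open>a = 0\<close> the
        correction has the factor 0, which matches the separate clause for index 1.\<close>
      moreover have "[:d h:] = H (Suc a)
          - [:(of_nat a * (of_nat a + of_rat k - 1)) *s 1:] * ([:E4:] * H (a - 1))"
        by (cases a) (simp_all add: H_def h_def Let_def mult_scale_1 mult.commute)
      ultimately show ?thesis
        by (simp only: poly_scale_eq_mult)
    qed
  qed (rule D.add)
  then show ?thesis
    by (simp add: H_def)
qed

theorem theorem3p1:
  fixes scale :: "'k::field_char_0 \<Rightarrow> 'm::comm_ring_1 \<Rightarrow> 'm"
    and N :: nat
    and M :: "rat \<Rightarrow> 'm set"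
    and d :: "'m \<Rightarrow> 'm"
    and E4 :: 'm
    and D :: "'m poly \<Rightarrow> 'm poly"
    and n :: nat
    and k l :: rat
    and f g :: 'm
  assumes "N > 0"
    and "graded_algebra scale N M"
    and "derivation scale d"
    and "has_degree N M 2 d"
    and "E4 \<in> M 4"
    and "extended_derivation scale N M d E4 D"
    and "k \<in> degrees N" and "l \<in> degrees N"
    and "f \<in> M k" and "g \<in> M l"
  shows "[:RC_bracket scale d E4 n k l f g:] = RC_bracket_poly scale D n k l [:f:] [:g:]"
proof -
  interpret graded_algebra scale N M
    by (rule assms(2))
  interpret scalar_hom "\<lambda>c. [:scale c 1:]"
    by (rule scalar_hom_const_poly)
  have "RC_bracket_poly scale D n k l [:f:] [:g:] =
      (\<Sum>j\<le>n. [:scale (RC_coeff k l n j) 1:] * ((D ^^ j) [:f:] * (D ^^ (n - j)) [:g:]))"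
    by (simp only: RC_bracket_poly_def poly_scale_eq_mult atLeast0AtMost)
  also have "\<dots> = (\<Sum>a\<le>n. [:scale (RC_coeff k l n a) 1:] *
      ([:higher_deriv scale d E4 k a f:] * [:higher_deriv scale d E4 l (n - a) g:]))"
    unfolding iterate_extended_derivation[OF assms(1,4,5,6,7,9)]
      iterate_extended_derivation[OF assms(1,4,5,6,8,10)]
    by (rule RC_ladder_sum)
  also have "\<dots> = [:RC_bracket scale d E4 n k l f g:]"
    by (simp add: RC_bracket_def sum_to_poly atLeast0AtMost scale_mult_left mult_scale_1 mult.commute)
  finally show ?thesis ..
qed

end
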